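(* Let $E$ be a (Hausdorff) topological vector space and let $F$ be a closed metrizable vector subspace of $E$ such that the quotient $E/F$ is a $\kappa$-Fréchet–Urysohn space. Then $E$ is also a $\kappa$-Fréchet–Urysohn space.
   Context: Topological vector spaces are over the field of real or complex numbers and are assumed Hausdorff (hence Tychonoff). The quotient $E/F$ carries the quotient vector space topology. $\omega=\{0,1,2,\dots\}$. A Tychonoff space $X$ is called $\kappa$-Fréchet–Urysohn if, for any open set $U\subseteq X$ and each point $x\in\overline{U}$, there exists a sequence $\{x_n\}_{n\in\omega}\subseteq U$ that converges to $x$. *)

theory Defs
  imports "HOL-Analysis.Analysis" "HOL-Library.Set_Algebras"
begin

definition Tychonoff_space :: "'a topology \<Rightarrow> bool"
  where "Tychonoff_space X \<longleftrightarrow> completely_regular_space X \<and> Hausdorff_space X"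

definition kappa_Frechet_Urysohn_space :: "'a topology \<Rightarrow> bool"
  where "kappa_Frechet_Urysohn_space X \<longleftrightarrow>
    Tychonoff_space X \<and>
    (\<forall>U x. openin X U \<and> x \<in> X closure_of U \<longrightarrow>
      (\<exists>s :: nat \<Rightarrow> 'a. range s \<subseteq> U \<and> limitin X s x sequentially))"

text \<open>
  The scalar field ranges over the class \<^class>\<open>real_normed_field\<close>, whose norm is multiplicative.
  By the Gelfand-Mazur theorem its instances are, up to isometric isomorphism, exactly the real
  and the complex numbers, so this class means ``real or complex scalars''.
\<close>

locale topological_vector_space = vector_space scale
  for scale :: "'k::real_normed_field \<Rightarrow> 'a::ab_group_add \<Rightarrow> 'a" (infixr \<open>*s\<close> 75) +
  fixes T :: "'a topology"
  assumes topspace_eq_UNIV: "topspace T = UNIV"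
    and Hausdorff: "Hausdorff_space T"
    and continuous_add: "continuous_map (prod_topology T T) T (\<lambda>(x, y). x + y)"
    and continuous_scale: "continuous_map (prod_topology euclidean T) T (\<lambda>(c, x). c *s x)"

text \<open>
  The points of the quotient by \<open>F\<close> are the cosets \<open>x +o F\<close>; a set of cosets is open iff its
  preimage under \<open>x \<mapsto> x +o F\<close> is open.
\<close>

definition quotient_space :: "'a::ab_group_add topology \<Rightarrow> 'a set \<Rightarrow> 'a set topology"
  where "quotient_space T F = topology (\<lambda>W.
    W \<subseteq> (\<lambda>x. x +o F) ` topspace T \<and> openin T {x \<in> topspace T. x +o F \<in> W})"

lemma openin_quotient_space:
  "openin (quotient_space T F) W \<longleftrightarrow>
    W \<subseteq> (\<lambda>x. x +o F) ` topspace T \<and> openin T {x \<in> topspace T. x +o F \<in> W}"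
proof -
  let ?P = "\<lambda>W. W \<subseteq> (\<lambda>x. x +o F) ` topspace T \<and> openin T {x \<in> topspace T. x +o F \<in> W}"
  have "?P (V \<inter> W)" if "?P V" "?P W" for V W
  proof -
    have "{x \<in> topspace T. x +o F \<in> V \<inter> W} =
        {x \<in> topspace T. x +o F \<in> V} \<inter> {x \<in> topspace T. x +o F \<in> W}" by auto
    then show ?thesis using that by (auto intro: openin_Int)
  qed
  moreover have "?P (\<Union>K)" if "\<forall>W\<in>K. ?P W" for K
  proof -
    have "{x \<in> topspace T. x +o F \<in> \<Union>K} = (\<Union>W\<in>K. {x \<in> topspace T. x +o F \<in> W})" by auto
    moreover have "openin T (\<Union>W\<in>K. {x \<in> topspace T. x +o F \<in> W})"
      using that by (intro openin_Union) auto
    ultimately show ?thesis using that by auto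
  qed
  ultimately have "istopology ?P" unfolding istopology_def by blast
  then show ?thesis unfolding quotient_space_def by (simp add: topology_inverse')
qed

lemma topspace_quotient_space:
  "topspace (quotient_space T F) = (\<lambda>x. x +o F) ` topspace T"
proof
  show "topspace (quotient_space T F) \<subseteq> (\<lambda>x. x +o F) ` topspace T"
    using openin_quotient_space openin_topspace by blast
  have "{x \<in> topspace T. x +o F \<in> (\<lambda>x. x +o F) ` topspace T} = topspace T" by auto
  then have "openin (quotient_space T F) ((\<lambda>x. x +o F) ` topspace T)"
    unfolding openin_quotient_space by simp
  then show "(\<lambda>x. x +o F) ` topspace T \<subseteq> topspace (quotient_space T F)"
    by (rule openin_subset)
qed

lemma quotient_map_quotient_space:
  "quotient_map T (quotient_space T F) (\<lambda>x. x +o F)"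
  unfolding quotient_map_def topspace_quotient_space openin_quotient_space by simp

end

theory Submission
  imports Defs
begin

text \<open>
  Since \<open>F\<close> is first countable, a sequence \<open>u\<close> tends to \<open>0\<close> in \<open>E\<close> as soon as it tends to \<open>0\<close> in
  \<open>E/F\<close> and eventually enters each member of a suitable sequence \<open>V n\<close> of neighbourhoods of \<open>0\<close>.
  To find such a sequence in an open set \<open>U\<close> with \<open>0\<close> in its closure, pick \<open>z \<notin> F\<close>, let \<open>z n\<close> be
  \<open>z\<close> divided by \<open>n + 1\<close>, and let \<open>P\<close> be the union of the sets \<open>z n + (U \<inter> V n \<inter> B n)\<close>,
  where \<open>B n\<close> is so small that the image of \<open>z n + B n\<close> in \<open>E/F\<close> stays away from \<open>0\<close>.
  The image of \<open>P\<close> is open with \<open>0\<close> in its closure, so it contains a sequence tending to \<open>0\<close>;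
  every index \<open>n\<close> is used only finitely often in it, and subtracting the \<open>z n\<close> gives the
  sequence in \<open>U\<close>.  Complete regularity of \<open>E\<close> is the Birkhoff-Kakutani argument.
\<close>

section \<open>Seminorms from chains of sets\<close>

text \<open>Birkhoff-Kakutani costs: \<open>ps\<close> writes \<open>x\<close> as a sum of pieces,
  and a piece taken from \<open>V n\<close> costs \<open>(1/2) ^ n\<close>. Lists allow repeated
  pieces and can be cut in two.\<close>

definition chain_sums :: "(nat \<Rightarrow> 'a::ab_group_add set) \<Rightarrow> 'a \<Rightarrow> real set"
  where "chain_sums V x =
    {\<Sum>p\<leftarrow>ps. (1/2) ^ fst p | ps. (\<forall>p\<in>set ps. snd p \<in> V (fst p)) \<and> sum_list (map snd ps) = x}"

text \<open>When \<open>V 0\<close> is everything, this is the largest subadditive function that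
  vanishes at 0 and is at most \<open>(1/2) ^ n\<close> on each \<open>V n\<close>. Homogeneity
  under scalars is not built in.\<close>

definition chain_seminorm :: "(nat \<Rightarrow> 'a::ab_group_add set) \<Rightarrow> 'a \<Rightarrow> real"
  where "chain_seminorm V x = Inf (chain_sums V x)"

lemma chain_sumsI:
  assumes "\<And>p. p \<in> set ps \<Longrightarrow> snd p \<in> V (fst p)"
  shows "(\<Sum>p\<leftarrow>ps. (1/2) ^ fst p) \<in> chain_sums V (sum_list (map snd ps))"
  using assms unfolding chain_sums_def by blast

lemma chain_sums_nonneg: "r \<in> chain_sums V x \<Longrightarrow> 0 \<le> r"
  unfolding chain_sums_def by (auto intro!: sum_list_nonneg)

lemma bdd_below_chain_sums: "bdd_below (chain_sums V x)"
  using chain_sums_nonneg by (intro bdd_belowI) blast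

lemma chain_sums_single: "x \<in> V n \<Longrightarrow> (1/2) ^ n \<in> chain_sums V x"
  using chain_sumsI[of "[(n, x)]" V] by simp

lemma chain_sums_add:
  assumes "r \<in> chain_sums V x" "s \<in> chain_sums V y"
  shows "r + s \<in> chain_sums V (x + y)"
proof -
  obtain ps qs where
    ps: "\<forall>p\<in>set ps. snd p \<in> V (fst p)" "sum_list (map snd ps) = x" "r = (\<Sum>p\<leftarrow>ps. (1/2) ^ fst p)" and
    qs: "\<forall>p\<in>set qs. snd p \<in> V (fst p)" "sum_list (map snd qs) = y" "s = (\<Sum>p\<leftarrow>qs. (1/2) ^ fst p)"
    using assms unfolding chain_sums_def by blast
  then show ?thesis using chain_sumsI[of "ps @ qs" V] by auto
qed

text \<open>Cut at the first entry with which the running total reaches \<open>c\<close>, or at the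
  last entry if there is none.\<close>

lemma sum_list_split_halves:
  fixes w :: "'b \<Rightarrow> real"
  assumes "ps \<noteq> []" "\<And>p. p \<in> set ps \<Longrightarrow> 0 \<le> w p" "(\<Sum>p\<leftarrow>ps. w p) < c + d" "0 < c" "0 < d"
  shows "\<exists>ys p zs. ps = ys @ p # zs \<and> (\<Sum>p\<leftarrow>ys. w p) < c \<and> (\<Sum>p\<leftarrow>zs. w p) < d"
  using assms
proof (induction ps arbitrary: c)
  case (Cons a ps)
  show ?case
  proof (cases "w a < c \<and> ps \<noteq> []")
    case True
    then obtain ys p zs where "ps = ys @ p # zs" "(\<Sum>p\<leftarrow>ys. w p) < c - w a" "(\<Sum>p\<leftarrow>zs. w p) < d"
      using Cons.IH[of "c - w a"] Cons.prems by auto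
    then show ?thesis by (intro exI[of _ "a # ys"] exI[of _ p] exI[of _ zs]) auto
  next
    case False
    then show ?thesis using Cons.prems by (intro exI[of _ "[]"] exI[of _ a] exI[of _ ps]) auto
  qed
qed simp

text \<open>Induction on the length of the chain: a cost below \<open>(1/2) ^ n\<close> is cut into
  two parts of cost below \<open>(1/2) ^ Suc n\<close> and one piece between them. All three sums
  lie in \<open>V (Suc n)\<close>, which is why the hypothesis speaks of triple sums.\<close>

lemma chain_sums_less_imp_mem:
  assumes zero: "\<And>n. 0 \<in> V n"
    and triple: "\<And>n x y z. \<lbrakk>x \<in> V (Suc n); y \<in> V (Suc n); z \<in> V (Suc n)\<rbrakk> \<Longrightarrow> x + y + z \<in> V n"
    and "r \<in> chain_sums V x" "r < (1/2) ^ n"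
  shows "x \<in> V n"
proof -
  have "V (Suc n) \<subseteq> V n" for n
    using triple[OF _ zero zero] by auto
  then have mono: "V n \<subseteq> V m" if "m \<le> n" for m n
    using that by (rule lift_Suc_antimono_le)
  have "sum_list (map snd ps) \<in> V n"
    if "\<forall>p\<in>set ps. snd p \<in> V (fst p)" "(\<Sum>p\<leftarrow>ps. (1/2) ^ fst p) < (1/2::real) ^ n" for ps n
    using that
  proof (induction ps arbitrary: n rule: length_induct)
    case (1 ps)
    show ?case
    proof (cases "ps = []")
      case False
      have "(\<Sum>p\<leftarrow>ps. (1/2) ^ fst p) < (1/2::real) ^ Suc n + (1/2) ^ Suc n" using 1(3) by simp
      then obtain ys p zs where split: "ps = ys @ p # zs"
        and ys: "(\<Sum>p\<leftarrow>ys. (1/2) ^ fst p) < (1/2::real) ^ Suc n"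
        and zs: "(\<Sum>p\<leftarrow>zs. (1/2) ^ fst p) < (1/2::real) ^ Suc n"
        using sum_list_split_halves[OF False, of "\<lambda>p. (1/2) ^ fst p" "(1/2) ^ Suc n" "(1/2) ^ Suc n"]
        by (meson half_gt_zero zero_less_one zero_less_power less_imp_le)
      have "0 \<le> (\<Sum>p\<leftarrow>ys. (1/2::real) ^ fst p)" "0 \<le> (\<Sum>p\<leftarrow>zs. (1/2::real) ^ fst p)"
        by (auto intro!: sum_list_nonneg)
      \<comment> \<open>The middle piece costs at most as much as the whole chain, and a power of
        1/2 strictly below \<open>(1/2) ^ n\<close> has exponent at least
        \<open>Suc n\<close>.\<close>
      then have "(1/2::real) ^ fst p < (1/2) ^ n" using 1(3) unfolding split
        by (simp del: power_strict_decreasing_iff)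
      then have "Suc n \<le> fst p" using power_decreasing[of "fst p" n "1/2::real"] by force
      then have "snd p \<in> V (Suc n)" using mono 1(2) split by auto
      moreover have "sum_list (map snd ys) \<in> V (Suc n)" "sum_list (map snd zs) \<in> V (Suc n)"
        using 1(1) 1(2) ys zs unfolding split by auto
      ultimately show ?thesis using triple unfolding split by (simp add: add.assoc[symmetric])
    qed (simp add: zero)
  qed
  then show ?thesis using assms(3,4) unfolding chain_sums_def by blast
qed

context
  fixes V :: "nat \<Rightarrow> 'a::ab_group_add set"
  assumes V0: "V 0 = UNIV"
begin

text \<open>As \<open>V 0\<close> is everything, \<open>x\<close> alone is a chain of cost 1, so the
  infimum is never taken over the empty set.\<close>

lemma chain_sums_nonempty: "chain_sums V x \<noteq> {}"
  using chain_sums_single[of x V 0] V0 by auto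

lemma chain_seminorm_nonneg: "0 \<le> chain_seminorm V x"
  unfolding chain_seminorm_def
  by (intro cInf_greatest chain_sums_nonempty chain_sums_nonneg)

lemma chain_seminorm_le: "x \<in> V n \<Longrightarrow> chain_seminorm V x \<le> (1/2) ^ n"
  unfolding chain_seminorm_def
  by (intro cInf_lower chain_sums_single bdd_below_chain_sums)

lemma chain_seminorm_zero: "chain_seminorm V 0 = 0"
proof -
  have "0 \<in> chain_sums V 0" using chain_sumsI[of "[]" V] by simp
  then have "chain_seminorm V 0 \<le> 0"
    unfolding chain_seminorm_def by (intro cInf_lower bdd_below_chain_sums)
  then show ?thesis using chain_seminorm_nonneg by (simp add: order_antisym)
qed

lemma chain_seminorm_add: "chain_seminorm V (x + y) \<le> chain_seminorm V x + chain_seminorm V y"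
proof (rule field_le_epsilon)
  fix e :: real assume "e > 0"
  then have "\<exists>r\<in>chain_sums V u. r < chain_seminorm V u + e/2" for u
    unfolding chain_seminorm_def by (intro cInf_lessD chain_sums_nonempty) simp
  then obtain r s where "r \<in> chain_sums V x" "r < chain_seminorm V x + e/2"
    "s \<in> chain_sums V y" "s < chain_seminorm V y + e/2"
    by meson
  moreover from this have "chain_seminorm V (x + y) \<le> r + s"
    unfolding chain_seminorm_def by (intro cInf_lower chain_sums_add bdd_below_chain_sums)
  ultimately show "chain_seminorm V (x + y) \<le> chain_seminorm V x + chain_seminorm V y + e" by simp
qed

lemma chain_seminorm_less_imp_mem:
  assumes "\<And>n. 0 \<in> V n"
    and "\<And>n x y z. \<lbrakk>x \<in> V (Suc n); y \<in> V (Suc n); z \<in> V (Suc n)\<rbrakk> \<Longrightarrow> x + y + z \<in> V n"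
    and "chain_seminorm V x < (1/2) ^ n"
  shows "x \<in> V n"
  using assms(3) cInf_lessD[OF chain_sums_nonempty] chain_sums_less_imp_mem[of V, OF assms(1,2)]
  unfolding chain_seminorm_def by blast

end

section \<open>Neighbourhoods of zero\<close>

lemma closure_of_meets:
  assumes "x \<in> X closure_of U" "openin X W" "x \<in> W"
  obtains u where "u \<in> U" "u \<in> W"
  using assms unfolding in_closure_of by metis

context topological_vector_space
begin

lemma continuous_map_add:
  assumes "continuous_map X T f" "continuous_map X T g"
  shows "continuous_map X T (\<lambda>x. f x + g x)"
  using continuous_map_compose[OF continuous_map_pairedI[OF assms] continuous_add]
  by (simp add: o_def)

lemma continuous_map_scale:
  assumes "continuous_map X euclidean f" "continuous_map X T g"
  shows "continuous_map X T (\<lambda>x. f x *s g x)"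
  using continuous_map_compose[OF continuous_map_pairedI[OF assms] continuous_scale]
  by (simp add: o_def)

lemma continuous_map_uminus:
  assumes "continuous_map X T f"
  shows "continuous_map X T (\<lambda>x. - f x)"
  using continuous_map_scale[OF _ assms, of "\<lambda>_. -1"] by simp

lemma continuous_map_diff:
  assumes "continuous_map X T f" "continuous_map X T g"
  shows "continuous_map X T (\<lambda>x. f x - g x)"
  using continuous_map_add[OF assms(1) continuous_map_uminus[OF assms(2)]] by simp

lemma openin_vimage:
  assumes "continuous_map T T f" "openin T W"
  shows "openin T {x. f x \<in> W}"
  using openin_continuous_map_preimage[OF assms] topspace_eq_UNIV by simp

lemma openin_translate:
  assumes "openin T W"
  shows "openin T {x. x + a \<in> W}" "openin T {x. x - a \<in> W}"
  by (intro openin_vimage[OF _ assms] continuous_map_add continuous_map_diff; simp add: topspace_eq_UNIV)+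

lemma nhd_zero_add:
  assumes "openin T W" "0 \<in> W"
  obtains A where "openin T A" "0 \<in> A" "\<And>x y. x \<in> A \<Longrightarrow> y \<in> A \<Longrightarrow> x + y \<in> W"
proof -
  have "openin (prod_topology T T) {p \<in> topspace (prod_topology T T). (case p of (x, y) \<Rightarrow> x + y) \<in> W}"
    using continuous_add assms(1) by (rule openin_continuous_map_preimage)
  moreover have "(0, 0) \<in> {p \<in> topspace (prod_topology T T). (case p of (x, y) \<Rightarrow> x + y) \<in> W}"
    using assms(2) topspace_eq_UNIV by simp
  ultimately obtain A B where "openin T A" "openin T B" "0 \<in> A" "0 \<in> B"
    "A \<times> B \<subseteq> {p \<in> topspace (prod_topology T T). (case p of (x, y) \<Rightarrow> x + y) \<in> W}"
    unfolding openin_prod_topology_alt by meson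
  then show ?thesis using that[of "A \<inter> B"] by (force intro: openin_Int)
qed

text \<open>Halving twice gives \<open>C + C\<close> inside \<open>B\<close> and
  \<open>B + B\<close> inside \<open>W\<close>. Since \<open>C\<close> lies in \<open>B\<close>,
  triple sums from \<open>C\<close> land in \<open>W\<close>; intersecting \<open>C\<close> with its
  negative gives symmetry.\<close>

lemma nhd_zero_triple:
  assumes "openin T W" "0 \<in> W"
  obtains A where "openin T A" "0 \<in> A" "A \<subseteq> W" "\<forall>x\<in>A. - x \<in> A"
    "\<forall>x\<in>A. \<forall>y\<in>A. \<forall>z\<in>A. x + y + z \<in> W"
proof -
  obtain B where B: "openin T B" "0 \<in> B" "\<And>x y. x \<in> B \<Longrightarrow> y \<in> B \<Longrightarrow> x + y \<in> W"
    using nhd_zero_add[OF assms] by metis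
  obtain C where C: "openin T C" "0 \<in> C" "\<And>x y. x \<in> C \<Longrightarrow> y \<in> C \<Longrightarrow> x + y \<in> B"
    using nhd_zero_add[OF B(1,2)] by metis
  have CB: "x \<in> B" if "x \<in> C" for x using C(3)[OF that C(2)] by simp
  have CW: "x \<in> W" if "x \<in> C" for x using B(3)[OF CB[OF that] B(2)] by simp
  have "openin T {x. - x \<in> C}"
    by (intro openin_vimage continuous_map_uminus C) simp
  then have "openin T (C \<inter> {x. - x \<in> C})" using C(1) by blast
  moreover have "C \<inter> {x. - x \<in> C} \<subseteq> W" using CW by blast
  ultimately show ?thesis using that[of "C \<inter> {x. - x \<in> C}"] C(2,3) B(3) CB by auto
qed

text \<open>Such a chain need not be a base at 0, since \<open>T\<close> may fail to be first
  countable; how small the \<open>V n\<close> are is prescribed where a chain is built.\<close>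

definition zero_chain :: "(nat \<Rightarrow> 'a set) \<Rightarrow> bool"
  where "zero_chain V \<longleftrightarrow> (\<forall>n. openin T (V n) \<and> 0 \<in> V n \<and> (\<forall>x\<in>V n. - x \<in> V n) \<and>
    (\<forall>x\<in>V (Suc n). \<forall>y\<in>V (Suc n). \<forall>z\<in>V (Suc n). x + y + z \<in> V n))"

lemma zero_chainD:
  assumes "zero_chain V"
  shows "openin T (V n)" "0 \<in> V n" "x \<in> V n \<Longrightarrow> - x \<in> V n"
    "\<lbrakk>x \<in> V (Suc n); y \<in> V (Suc n); z \<in> V (Suc n)\<rbrakk> \<Longrightarrow> x + y + z \<in> V n"
  using assms unfolding zero_chain_def by blast+

lemma zero_chain_antimono:
  assumes "zero_chain V" "m \<le> n"
  shows "V n \<subseteq> V m"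
proof -
  have "V (Suc k) \<subseteq> V k" for k
    using zero_chainD(4)[OF assms(1) _ zero_chainD(2)[OF assms(1)] zero_chainD(2)[OF assms(1)]] by auto
  then show ?thesis using assms(2) by (rule lift_Suc_antimono_le)
qed

lemma zero_chain_exists:
  assumes "\<And>n. openin T (A n)" "\<And>n. 0 \<in> A n"
  obtains V where "zero_chain V" "V 0 = UNIV" "\<And>n. V (Suc n) \<subseteq> A n"
proof -
  \<comment> \<open>The slot \<open>n = 0\<close> is fixed to be everything, as the chain seminorm
    requires, so \<open>A n\<close> constrains \<open>V (Suc n)\<close>.\<close>
  let ?P = "\<lambda>(n::nat) W. openin T W \<and> 0 \<in> W \<and> (\<forall>x\<in>W. - x \<in> W) \<and> (n = 0 \<longrightarrow> W = UNIV)"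
  let ?Q = "\<lambda>n W W'. W' \<subseteq> A n \<and> (\<forall>x\<in>W'. \<forall>y\<in>W'. \<forall>z\<in>W'. x + y + z \<in> W)"
  have "\<exists>V. \<forall>n. ?P n (V n) \<and> ?Q n (V n) (V (Suc n))"
  proof (rule dependent_nat_choice)
    show "\<exists>W. ?P 0 W" using openin_topspace[of T] by (auto simp: topspace_eq_UNIV)
  next
    fix W n assume W: "?P n W"
    then have "openin T (W \<inter> A n)" "0 \<in> W \<inter> A n" using assms by blast+
    then obtain B where "openin T B" "0 \<in> B" "B \<subseteq> W \<inter> A n" "\<forall>x\<in>B. - x \<in> B"
      "\<forall>x\<in>B. \<forall>y\<in>B. \<forall>z\<in>B. x + y + z \<in> W \<inter> A n"
      by (rule nhd_zero_triple) blast
    then show "\<exists>W'. ?P (Suc n) W' \<and> ?Q n W W'" by (intro exI[of _ B]) blast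
  qed
  then obtain V where "\<forall>n. ?P n (V n) \<and> ?Q n (V n) (V (Suc n))" ..
  then show ?thesis using that[of V] unfolding zero_chain_def by blast
qed

lemma limitin_zero_iff:
  "limitin T s 0 sequentially \<longleftrightarrow> (\<forall>W. openin T W \<and> 0 \<in> W \<longrightarrow> (\<forall>\<^sub>F k in sequentially. s k \<in> W))"
  by (simp add: limitin_def topspace_eq_UNIV)

section \<open>Complete regularity through the chain seminorm\<close>

lemma continuous_map_chain_seminorm:
  assumes V: "zero_chain V" "V 0 = UNIV"
  shows "continuous_map T euclideanreal (\<lambda>y. chain_seminorm V (y - a))"
proof -
  have "\<exists>W. openin T W \<and> y \<in> W \<and> (\<forall>u\<in>W. dist (chain_seminorm V (u - a)) (chain_seminorm V (y - a)) < e)"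
    if "e > 0" for y and e :: real
  proof -
    obtain n where n: "(1/2) ^ n < e" using real_arch_pow_inv[OF \<open>e > 0\<close>, of "1/2"] by auto
    have "dist (chain_seminorm V (u - a)) (chain_seminorm V (y - a)) < e" if u: "u - y \<in> V n" for u
    proof -
      \<comment> \<open>Symmetry of \<open>V n\<close> lets subadditivity bound the difference of
        the two values in both directions.\<close>
      have "y - u \<in> V n" using zero_chainD(3)[OF V(1) u] by simp
      then have "chain_seminorm V (u - y) < e" "chain_seminorm V (y - u) < e"
        using chain_seminorm_le[of V _ n] V(2) u n by fastforce+
      then show ?thesis
        using chain_seminorm_add[of V "u - y" "y - a"] chain_seminorm_add[of V "y - u" "u - a"] V(2)
        by (simp add: dist_real_def abs_less_iff)
    qed
    then show ?thesis
      using openin_translate(2)[OF zero_chainD(1)[OF V(1)], of y n] zero_chainD(2)[OF V(1)]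
      by (intro exI[of _ "{u. u - y \<in> V n}"]) auto
  qed
  then show ?thesis
    using Met_TC.continuous_map_to_metric[of T "\<lambda>y. chain_seminorm V (y - a)"]
    by (simp add: dist_commute)
qed

lemma Tychonoff_space_topological_vector_space: "Tychonoff_space T"
proof -
  have "\<exists>f. continuous_map T (top_of_set {0..1::real}) f \<and> f a = 0 \<and> f ` S \<subseteq> {1}"
    if S: "closedin T S" "a \<in> topspace T - S" for S a
  proof -
    let ?A = "{y. y + a \<in> topspace T - S}"
    have "openin T ?A" using S(1) by (intro openin_translate) blast
    moreover have "0 \<in> ?A" using S(2) by simp
    \<comment> \<open>A constant prescription is enough: \<open>V 1\<close> inside \<open>?A\<close>
      already keeps \<open>?N (y - a)\<close> at least 1/2 for \<open>y\<close> in
      \<open>S\<close>.\<close>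
    ultimately obtain V where V: "zero_chain V" "V 0 = UNIV" "\<And>n. V (Suc n) \<subseteq> ?A"
      using zero_chain_exists[of "\<lambda>_. ?A"] by blast
    let ?N = "chain_seminorm V"
    have far: "1/2 \<le> ?N (y - a)" if "y \<in> S" for y
    proof (rule ccontr)
      assume "\<not> 1/2 \<le> ?N (y - a)"
      then have "y - a \<in> V 1"
        using chain_seminorm_less_imp_mem[of V "y - a" 1] zero_chainD[OF V(1)] V(2) by auto
      then show False using V(3)[of 0] that by auto
    qed
    \<comment> \<open>Doubling turns the bound 1/2 into 1, and \<open>min\<close> makes the value
      exactly 1 on \<open>S\<close>.\<close>
    have "continuous_map T euclideanreal (\<lambda>y. min 1 (2 * ?N (y - a)))"
      by (intro continuous_map_real_min continuous_map_real_mult continuous_map_chain_seminorm V) auto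
    moreover have "min 1 (2 * ?N (y - a)) \<in> {0..1}" for y
      using chain_seminorm_nonneg[of V] V(2) by simp
    moreover have "min 1 (2 * ?N (a - a)) = 0" using chain_seminorm_zero[of V] V(2) by simp
    moreover have "(\<lambda>y. min 1 (2 * ?N (y - a))) ` S \<subseteq> {1}" using far by force
    ultimately show ?thesis
      by (intro exI[of _ "\<lambda>y. min 1 (2 * ?N (y - a))"]) (auto simp: continuous_map_in_subtopology)
  qed
  then show ?thesis
    unfolding Tychonoff_space_def completely_regular_space_def using Hausdorff by blast
qed

section \<open>Lifting sequences from the quotient\<close>

lemma coset_eq_iff:
  assumes "subspace F"
  shows "x +o F = y +o F \<longleftrightarrow> x - y \<in> F"
proof
  assume "x +o F = y +o F"
  moreover have "x \<in> x +o F" using subspace_0[OF assms] by (force simp: elt_set_plus_def)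
  ultimately show "x - y \<in> F" by (auto simp: elt_set_plus_def)
next
  have sub: "u +o F \<subseteq> v +o F" if "u - v \<in> F" for u v
  proof
    fix t assume "t \<in> u +o F"
    then obtain f where "f \<in> F" "t = u + f" by (auto simp: elt_set_plus_def)
    then show "t \<in> v +o F"
      using subspace_add[OF assms that] by (force simp: elt_set_plus_def algebra_simps)
  qed
  assume "x - y \<in> F"
  moreover from this have "y - x \<in> F" using subspace_neg[OF assms] by fastforce
  ultimately show "x +o F = y +o F" using sub by blast
qed

text \<open>The saturation of \<open>P\<close> is the union of its translates by elements of
  \<open>F\<close>, so the quotient map is open.\<close>

lemma openin_quotient_image:
  assumes "subspace F" "openin T P"
  shows "openin (quotient_space T F) ((\<lambda>x. x +o F) ` P)"
proof -
  have "x +o F \<in> (\<lambda>x. x +o F) ` P \<longleftrightarrow> (\<exists>f\<in>F. x - f \<in> P)" for x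
  proof
    assume "x +o F \<in> (\<lambda>x. x +o F) ` P"
    then obtain p where "p \<in> P" "x - p \<in> F" using coset_eq_iff[OF assms(1)] by auto
    then show "\<exists>f\<in>F. x - f \<in> P" by (intro bexI[of _ "x - p"]) auto
  next
    assume "\<exists>f\<in>F. x - f \<in> P"
    then obtain f where "f \<in> F" "x - f \<in> P" by blast
    then show "x +o F \<in> (\<lambda>x. x +o F) ` P"
      using coset_eq_iff[OF assms(1), of x "x - f"] by auto
  qed
  then have "{x \<in> topspace T. x +o F \<in> (\<lambda>x. x +o F) ` P} = (\<Union>f\<in>F. {x. x - f \<in> P})"
    using topspace_eq_UNIV by auto
  moreover have "openin T (\<Union>f\<in>F. {x. x - f \<in> P})"
    using openin_translate(2)[OF assms(2)] by blast
  ultimately show ?thesis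
    unfolding openin_quotient_space using topspace_eq_UNIV by auto
qed

text \<open>For a subspace \<open>F\<close> this is convergence of the cosets
  \<open>s k +o F\<close> to the zero coset in the quotient, expressed through
  representatives.\<close>

definition vanishes_modulo :: "'a set \<Rightarrow> (nat \<Rightarrow> 'a) \<Rightarrow> bool"
  where "vanishes_modulo F s \<longleftrightarrow>
    (\<forall>W. openin T W \<and> 0 \<in> W \<longrightarrow> (\<forall>\<^sub>F k in sequentially. \<exists>w\<in>W. s k - w \<in> F))"

lemma vanishes_moduloD:
  "\<lbrakk>vanishes_modulo F s; openin T W; 0 \<in> W\<rbrakk> \<Longrightarrow> \<forall>\<^sub>F k in sequentially. \<exists>w\<in>W. s k - w \<in> F"
  unfolding vanishes_modulo_def by blast

lemma limitin_quotient_imp_vanishes_modulo: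
  assumes "subspace F" "limitin (quotient_space T F) (\<lambda>k. s k +o F) (0 +o F) sequentially"
  shows "vanishes_modulo F s"
  unfolding vanishes_modulo_def
proof (intro allI impI)
  fix W assume "openin T W \<and> 0 \<in> W"
  then have "\<forall>\<^sub>F k in sequentially. s k +o F \<in> (\<lambda>x. x +o F) ` W"
    using assms(2) openin_quotient_image[OF assms(1)] unfolding limitin_def by blast
  then show "\<forall>\<^sub>F k in sequentially. \<exists>w\<in>W. s k - w \<in> F"
    by eventually_elim (auto simp: coset_eq_iff[OF assms(1)])
qed

text \<open>Split \<open>s k\<close> as \<open>w + (s k - w)\<close> with \<open>w\<close> small.
  The second summand lies in \<open>F\<close> and, \<open>s k\<close> and \<open>w\<close> both
  being deep in the chain, in \<open>V m\<close>; on \<open>F\<close> the chain controls the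
  topology.\<close>

lemma vanishes_modulo_imp_limitin:
  assumes V: "zero_chain V" "\<And>W. \<lbrakk>openin T W; 0 \<in> W\<rbrakk> \<Longrightarrow> \<exists>n. V n \<inter> F \<subseteq> W"
    and s: "\<And>k. s k \<in> V (i k)" "filterlim i at_top sequentially" "vanishes_modulo F s"
  shows "limitin T s 0 sequentially"
  unfolding limitin_zero_iff
proof (intro allI impI)
  fix W assume "openin T W \<and> 0 \<in> W"
  then have "openin T W" "0 \<in> W" by auto
  then obtain A where A: "openin T A" "0 \<in> A" "A \<subseteq> W" "\<forall>x\<in>A. - x \<in> A"
    "\<forall>x\<in>A. \<forall>y\<in>A. \<forall>z\<in>A. x + y + z \<in> W"
    by (rule nhd_zero_triple) blast
  obtain m where m: "V m \<inter> F \<subseteq> A" using V(2) A(1,2) by blast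
  \<comment> \<open>\<open>w\<close> is sought in \<open>V (Suc m)\<close> so that its difference
    from \<open>s k\<close>, also in \<open>V (Suc m)\<close>, falls into
    \<open>V m\<close>.\<close>
  have "openin T (A \<inter> V (Suc m))" "0 \<in> A \<inter> V (Suc m)"
    using A zero_chainD[OF V(1)] by auto
  then have "\<forall>\<^sub>F k in sequentially. \<exists>w\<in>A \<inter> V (Suc m). s k - w \<in> F"
    using vanishes_moduloD[OF s(3)] by blast
  moreover have "\<forall>\<^sub>F k in sequentially. Suc m \<le> i k"
    using s(2) unfolding filterlim_at_top by blast
  ultimately show "\<forall>\<^sub>F k in sequentially. s k \<in> W"
  proof eventually_elim
    case (elim k)
    then obtain w where w: "w \<in> A" "w \<in> V (Suc m)" "s k - w \<in> F" by blast
    have "s k \<in> V (Suc m)" using s(1) zero_chain_antimono[OF V(1) elim(2)] by blast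
    \<comment> \<open>The summand 0 reduces the triple-sum property to two summands.\<close>
    then have "s k + - w + 0 \<in> V m" using zero_chainD[OF V(1)] w(2) by blast
    then have "s k - w \<in> A" using m w(3) by auto
    then have "w + (s k - w) + 0 \<in> W" using A w(1) by blast
    then show ?case by simp
  qed
qed

text \<open>The members containing 0 of a countable local base in \<open>F\<close> are traces of
  open sets \<open>A n\<close> of \<open>T\<close>; a chain chosen below the \<open>A n\<close>
  therefore has traces that are again a base at 0 in \<open>F\<close>.\<close>

lemma first_countable_subspace_chain:
  assumes F: "subspace F" "first_countable (subtopology T F)"
  obtains V where "zero_chain V" "\<And>W. \<lbrakk>openin T W; 0 \<in> W\<rbrakk> \<Longrightarrow> \<exists>n. V n \<inter> F \<subseteq> W"
proof -
  have "0 \<in> F" using F(1) by (rule subspace_0)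
  then obtain B where B: "countable B" "\<And>W. W \<in> B \<Longrightarrow> openin (subtopology T F) W"
    "\<And>U. \<lbrakk>openin (subtopology T F) U; 0 \<in> U\<rbrakk> \<Longrightarrow> \<exists>W\<in>B. 0 \<in> W \<and> W \<subseteq> U"
    using F(2) unfolding first_countable_def by (auto simp: topspace_eq_UNIV)
  let ?B = "{W \<in> B. 0 \<in> W}"
  have "?B \<noteq> {}" using B(3)[OF openin_topspace] \<open>0 \<in> F\<close> by (auto simp: topspace_eq_UNIV)
  moreover have "countable ?B" using B(1) by (rule countable_subset[rotated]) auto
  ultimately have range: "range (from_nat_into ?B) = ?B" by (rule range_from_nat_into)
  have "\<exists>A. openin T A \<and> from_nat_into ?B n = A \<inter> F" for n
    using B(2) range unfolding openin_subtopology by blast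
  then obtain A where A: "\<And>n. openin T (A n)" "\<And>n. from_nat_into ?B n = A n \<inter> F" by metis
  have "0 \<in> A n" for n using A(2)[of n] range by blast
  then obtain V where V: "zero_chain V" "\<And>n. V (Suc n) \<subseteq> A n"
    using zero_chain_exists[of A] A(1) by metis
  have "\<exists>n. V n \<inter> F \<subseteq> W" if W: "openin T W" "0 \<in> W" for W
  proof -
    have "openin (subtopology T F) (W \<inter> F)" using W(1) by (auto simp: openin_subtopology)
    then obtain C where "C \<in> ?B" "C \<subseteq> W \<inter> F" using B(3) W(2) \<open>0 \<in> F\<close> by blast
    moreover have "C \<in> range (from_nat_into ?B)" using \<open>C \<in> ?B\<close> by (simp only: range)
    then obtain n where "C = A n \<inter> F" unfolding A(2) by blast
    ultimately have "V (Suc n) \<inter> F \<subseteq> W" using V(2) by blast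
    then show ?thesis ..
  qed
  then show ?thesis using that V(1) by blast
qed

text \<open>In the quotient the images of \<open>z + B\<close> and \<open>B\<close> are disjoint;
  this keeps a piece shifted by a fixed \<open>z\<close> away from the zero coset.\<close>

lemma nhd_zero_separating:
  assumes "closedin T F" "z \<notin> F"
  obtains B where "openin T B" "0 \<in> B" "\<And>x y. x \<in> B \<Longrightarrow> y \<in> B \<Longrightarrow> z + x - y \<notin> F"
proof -
  let ?W = "{x. x + z \<in> topspace T - F}"
  have "openin T ?W" using assms(1) by (intro openin_translate) blast
  moreover have "0 \<in> ?W" using assms(2) topspace_eq_UNIV by simp
  ultimately obtain A where A: "openin T A" "0 \<in> A" "A \<subseteq> ?W" "\<forall>x\<in>A. - x \<in> A"
    "\<forall>x\<in>A. \<forall>y\<in>A. \<forall>z\<in>A. x + y + z \<in> ?W"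
    by (rule nhd_zero_triple) blast
  have "z + x - y \<notin> F" if "x \<in> A" "y \<in> A" for x y
  proof -
    have "x + - y + 0 \<in> ?W" using A that by blast
    then show ?thesis by (simp add: algebra_simps)
  qed
  then show ?thesis using that A by blast
qed

lemma limitin_inverse_scale: "limitin T (\<lambda>n. inverse (of_nat (Suc n)) *s z) 0 sequentially"
proof -
  have "continuous_map euclidean T (\<lambda>c. c *s z)"
    by (intro continuous_map_scale) (auto simp: topspace_eq_UNIV)
  \<comment> \<open>The norm of each scalar is the corresponding real reciprocal, which reduces the
    limit to the reals.\<close>
  moreover have "limitin euclidean (\<lambda>n. inverse (of_nat (Suc n)) :: 'k) 0 sequentially"
    using LIMSEQ_inverse_real_of_nat
    by (subst limitin_canonical_iff, subst tendsto_norm_zero_iff[symmetric])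
      (simp only: norm_inverse norm_of_nat)
  ultimately show ?thesis
    by (auto simp: o_def dest: continuous_map_limit)
qed

text \<open>The quotient does not see how deep in the chain a point lies. The shift by
  \<open>zs n\<close> makes the depth \<open>n\<close> visible there and is undone once the sequence
  is found.\<close>

lemma sequence_vanishing_modulo_subspace:
  assumes F: "subspace F" "closedin T F" "F \<noteq> UNIV" "kappa_Frechet_Urysohn_space (quotient_space T F)"
    and V: "zero_chain V" and U: "openin T U" "0 \<in> T closure_of U"
  obtains s i where "\<And>k. s k \<in> U \<inter> V (i k)" "filterlim i at_top sequentially" "vanishes_modulo F s"
proof -
  obtain z where "z \<notin> F" using F(3) by blast
  define zs where "zs n = inverse (of_nat (Suc n)) *s z" for n
  have zs0: "limitin T zs 0 sequentially" unfolding zs_def by (rule limitin_inverse_scale)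
  have "zs n \<notin> F" for n
  proof
    assume "zs n \<in> F"
    then have "of_nat (Suc n) *s zs n \<in> F" using F(1) by (rule subspace_scale[rotated])
    moreover have "of_nat (Suc n) * inverse (of_nat (Suc n)) = (1::'k)"
      by (rule right_inverse) (metis of_nat_neq_0)
    ultimately show False using \<open>z \<notin> F\<close> unfolding zs_def by (simp only: scale_scale scale_one)
  qed
  then have "\<exists>B. openin T B \<and> 0 \<in> B \<and> (\<forall>x\<in>B. \<forall>y\<in>B. zs n + x - y \<notin> F)" for n
    using nhd_zero_separating[OF F(2)] by metis
  then obtain B where B: "\<And>n. openin T (B n)" "\<And>n. 0 \<in> B n"
    "\<And>n x y. x \<in> B n \<Longrightarrow> y \<in> B n \<Longrightarrow> zs n + x - y \<notin> F" by metis
  define P where "P = (\<Union>n. {x. x - zs n \<in> U \<inter> V n \<inter> B n})"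
  have "openin T P" unfolding P_def
    using openin_translate(2) U(1) zero_chainD(1)[OF V] B(1) by (intro openin_Union) blast
  have "0 \<in> T closure_of P"
    unfolding in_closure_of
  proof (intro conjI allI impI)
    fix W assume W: "0 \<in> W \<and> openin T W"
    then obtain n where n: "zs n \<in> W"
      using zs0 eventually_happens'[OF sequentially_bot] unfolding limitin_zero_iff by metis
    \<comment> \<open>\<open>W\<close> moved back by \<open>zs n\<close> is a neighbourhood of 0, so
      \<open>U\<close> meets it inside \<open>V n\<close> and \<open>B n\<close>.\<close>
    have "openin T ({x. x + zs n \<in> W} \<inter> V n \<inter> B n)"
      using W B(1) zero_chainD(1)[OF V] by (intro openin_Int openin_translate) auto
    moreover have "0 \<in> {x. x + zs n \<in> W} \<inter> V n \<inter> B n"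
      using n B(2) zero_chainD(2)[OF V] by simp
    ultimately obtain u where "u \<in> U" "u \<in> {x. x + zs n \<in> W} \<inter> V n \<inter> B n"
      by (rule closure_of_meets[OF U(2)])
    then have "u + zs n \<in> P" "u + zs n \<in> W" unfolding P_def by (auto intro!: exI[of _ n])
    then show "\<exists>y. y \<in> P \<and> y \<in> W" by blast
  qed (simp add: topspace_eq_UNIV)
  then have "0 +o F \<in> quotient_space T F closure_of ((\<lambda>x. x +o F) ` P)"
    using continuous_map_image_closure_subset[OF quotient_imp_continuous_map[OF quotient_map_quotient_space[of T F]], of P]
    by blast
  then obtain t where t: "range t \<subseteq> (\<lambda>x. x +o F) ` P" "limitin (quotient_space T F) t (0 +o F) sequentially"
    using F(4) openin_quotient_image[OF F(1) \<open>openin T P\<close>]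
    unfolding kappa_Frechet_Urysohn_space_def by blast
  have "\<exists>p n. t k = p +o F \<and> p - zs n \<in> U \<inter> V n \<inter> B n" for k
  proof -
    have "t k \<in> (\<lambda>x. x +o F) ` P" using t(1) by blast
    then show ?thesis unfolding P_def by blast
  qed
  \<comment> \<open>\<open>p k\<close> represents the coset \<open>t k\<close> inside
    \<open>P\<close>, and \<open>i k\<close> names a piece of \<open>P\<close> containing
    it.\<close>
  then obtain p i where p: "\<And>k. t k = p k +o F" "\<And>k. p k - zs (i k) \<in> U \<inter> V (i k) \<inter> B (i k)"
    by metis
  have vp: "vanishes_modulo F p"
    using t(2) p(1) by (intro limitin_quotient_imp_vanishes_modulo[OF F(1)]) (simp flip: p(1))
  \<comment> \<open>If \<open>i k = n\<close>, then \<open>p k\<close> lies in \<open>B n\<close>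
    shifted by \<open>zs n\<close>, whereas \<open>vp\<close> eventually makes it congruent modulo
    \<open>F\<close> to an element of \<open>B n\<close>.\<close>
  have avoid: "\<forall>\<^sub>F k in sequentially. i k \<noteq> n" for n
    using vanishes_moduloD[OF vp B(1)[of n] B(2)]
  proof eventually_elim
    case (elim k)
    then obtain w where w: "w \<in> B n" "p k - w \<in> F" by blast
    show ?case
    proof
      assume "i k = n"
      then have "zs n + (p k - zs n) - w \<notin> F" using p(2)[of k] w(1) B(3) by blast
      then show False using w(2) by simp
    qed
  qed
  have i: "filterlim i at_top sequentially"
    unfolding filterlim_at_top
  proof
    fix m
    have "\<forall>\<^sub>F k in sequentially. \<forall>n\<in>{..<m}. i k \<noteq> n"
      using avoid by (intro eventually_ball_finite) auto
    then show "\<forall>\<^sub>F k in sequentially. m \<le> i k"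
      by eventually_elim (use not_le in auto)
  qed
  \<comment> \<open>Since \<open>i\<close> tends to infinity, the shifts \<open>zs (i k)\<close>
    tend to 0, so subtracting them preserves vanishing modulo \<open>F\<close>.\<close>
  have "vanishes_modulo F (\<lambda>k. p k - zs (i k))"
    unfolding vanishes_modulo_def
  proof (intro allI impI)
    fix W assume "openin T W \<and> 0 \<in> W"
    then have "openin T W" "0 \<in> W" by auto
    then obtain A where A: "openin T A" "0 \<in> A" "A \<subseteq> W" "\<forall>x\<in>A. - x \<in> A"
      "\<forall>x\<in>A. \<forall>y\<in>A. \<forall>z\<in>A. x + y + z \<in> W"
      by (rule nhd_zero_triple) blast
    have "\<forall>\<^sub>F n in sequentially. zs n \<in> A" using zs0 A unfolding limitin_zero_iff by blast
    then have "\<forall>\<^sub>F k in sequentially. zs (i k) \<in> A" using i by (rule eventually_compose_filterlim)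
    with vanishes_moduloD[OF vp A(1,2)]
    show "\<forall>\<^sub>F k in sequentially. \<exists>w\<in>W. p k - zs (i k) - w \<in> F"
    proof eventually_elim
      case (elim k)
      then obtain w where w: "w \<in> A" "p k - w \<in> F" by blast
      have "w + - zs (i k) + 0 \<in> W" using A w(1) elim(2) by blast
      then show ?case using w(2) by (intro bexI[of _ "w - zs (i k)"]) auto
    qed
  qed
  then show ?thesis using that[of "\<lambda>k. p k - zs (i k)" i] p(2) i by blast
qed

section \<open>Sequences in open sets converging to 0, then to arbitrary points\<close>

lemma sequence_limitin_zero:
  assumes F: "subspace F" "closedin T F" "first_countable (subtopology T F)"
      "kappa_Frechet_Urysohn_space (quotient_space T F)"
    and U: "openin T U" "0 \<in> T closure_of U"
  obtains s :: "nat \<Rightarrow> 'a" where "range s \<subseteq> U" "limitin T s 0 sequentially"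
proof -
  obtain V where V: "zero_chain V" "\<And>W. \<lbrakk>openin T W; 0 \<in> W\<rbrakk> \<Longrightarrow> \<exists>n. V n \<inter> F \<subseteq> W"
    using first_countable_subspace_chain[OF F(1,3)] by blast
  obtain s i where s: "\<And>k. s k \<in> U \<inter> V (i k)" "filterlim i at_top sequentially" "vanishes_modulo F s"
  proof (cases "F = UNIV")
    \<comment> \<open>Here no \<open>z\<close> outside \<open>F\<close> exists, but the chain is a
      base at 0 of the whole space, so points of \<open>U\<close> in \<open>V k\<close> serve, with
      \<open>i\<close> the identity.\<close>
    case True
    have "\<exists>u. u \<in> U \<inter> V k" for k
      using closure_of_meets[OF U(2) zero_chainD(1,2)[OF V(1)]] by blast
    then obtain s where "\<And>k. s k \<in> U \<inter> V k" by metis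
    moreover have "vanishes_modulo F s"
      unfolding vanishes_modulo_def using True by (auto intro: always_eventually)
    ultimately show ?thesis using that[of s "\<lambda>k. k"] filterlim_ident by blast
  next
    case False
    then show ?thesis using sequence_vanishing_modulo_subspace[OF F(1,2) _ F(4) V(1) U] that by blast
  qed
  have "limitin T s 0 sequentially"
    using vanishes_modulo_imp_limitin[OF V _ s(2,3)] s(1) by blast
  then show ?thesis using that s(1) by blast
qed

lemma kappa_Frechet_Urysohn_extension:
  assumes F: "subspace F" "closedin T F" "first_countable (subtopology T F)"
    "kappa_Frechet_Urysohn_space (quotient_space T F)"
  shows "kappa_Frechet_Urysohn_space T"
  unfolding kappa_Frechet_Urysohn_space_def
proof (intro conjI Tychonoff_space_topological_vector_space allI impI; elim conjE)
  fix U x assume U: "openin T U" "x \<in> T closure_of U"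
  \<comment> \<open>Translation by \<open>x\<close> is a homeomorphism and moves the point to
    0.\<close>
  let ?U = "{y. y + x \<in> U}"
  have "0 \<in> T closure_of ?U"
    unfolding in_closure_of
  proof (intro conjI allI impI)
    fix W assume "0 \<in> W \<and> openin T W"
    then have "openin T {y. y - x \<in> W}" "x \<in> {y. y - x \<in> W}" using openin_translate(2) by auto
    then obtain y where "y \<in> U" "y \<in> {y. y - x \<in> W}" by (rule closure_of_meets[OF U(2)])
    then show "\<exists>y. y \<in> ?U \<and> y \<in> W" by (intro exI[of _ "y - x"]) auto
  qed (simp add: topspace_eq_UNIV)
  then obtain s :: "nat \<Rightarrow> 'a" where s: "range s \<subseteq> ?U" "limitin T s 0 sequentially"
    using sequence_limitin_zero[OF F openin_translate(1)[OF U(1)]] by blast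
  have "limitin T (\<lambda>k. s k + x) x sequentially"
    unfolding limitin_def
  proof (intro conjI allI impI)
    fix W assume "openin T W \<and> x \<in> W"
    then have "openin T {y. y + x \<in> W}" "0 \<in> {y. y + x \<in> W}" using openin_translate(1) by auto
    then have "\<forall>\<^sub>F k in sequentially. s k \<in> {y. y + x \<in> W}"
      using s(2) unfolding limitin_zero_iff by blast
    then show "\<forall>\<^sub>F k in sequentially. s k + x \<in> W" by simp
  qed (simp add: topspace_eq_UNIV)
  then show "\<exists>s :: nat \<Rightarrow> 'a. range s \<subseteq> U \<and> limitin T s x sequentially"
    using s(1) by (intro exI[of _ "\<lambda>k. s k + x"]) auto
qed

end

theorem proposition2p4:
  fixes scale :: "'k::real_normed_field \<Rightarrow> 'a::ab_group_add \<Rightarrow> 'a"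
    and T :: "'a topology"
    and F :: "'a set"
  assumes "topological_vector_space scale T"
    and "module.subspace scale F"
    and "closedin T F"
    and "metrizable_space (subtopology T F)"
    and "kappa_Frechet_Urysohn_space (quotient_space T F)"
  shows "kappa_Frechet_Urysohn_space T"
  using topological_vector_space.kappa_Frechet_Urysohn_extension[OF assms(1-3)
      metrizable_imp_first_countable[OF assms(4)] assms(5)] .

end
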